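(* Let $\mathcal{P}_{\mathsf c}$ be the countable powerset functor on $\mathbf{Set}$. For any cardinal $\lambda$, the following are equivalent. (1) Some element of $\nu^{(\omega_1)}\mathcal{P}_{\mathsf c}$ has precisely $\lambda$ successors. (2) There is a tidy $\omega_1$-tree, with all levels countable, that has precisely $\lambda$ full branches.
   Context: Work in ZFC. $\mathcal{P}_{\mathsf c}X$ is the set of countable (finite or countably infinite) subsets of $X$; it is a functor via direct image. $0$ is deemed a limit ordinal. Final chain of an endofunctor $F$ on $\mathbf{Set}$: sets $\nu^{(i)}F$ for all ordinals $i$, with functorial connecting maps $\nu^{(i\geqslant j)}:\nu^{(i)}F\to\nu^{(j)}F$ for $j\leqslant i$, determined by: $\nu^{(i+1)}F=F\nu^{(i)}F$ and $\nu^{(i+1\geqslant j+1)}=F\nu^{(i\geqslant j)}$; for $i$ a limit, $\nu^{(i)}F$ is the set of families $(x_j)_{j<i}$ with $x_j\in\nu^{(j)}F$ and $\nu^{(j\geqslant k)}x_j=x_k$ for $k\leqslant j<i$, and $\nu^{(i\geqslant j)}x=x_j$ for $j<i$. So $\nu^{(0)}F=\{()\}$. For a limit $i$ and $a,b\in\nu^{(i)}\mathcal{P}_{\mathsf c}$, $b$ is a successor of $a$ when $b_j\in a_{j+1}$ for all $j<i$. A tidy $\omega_1$-tree is a functor $D:\omega_1^{\mathrm{op}}\to\mathbf{Set}$ (levels $D_i$ for $i<\omega_1$, connecting maps $D_i\to D_j$ for $j\leqslant i<\omega_1$) such that all connecting maps are surjective, for each limit $i<\omega_1$ every full branch of $(D_j)_{j<i}$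 has at most one extension to a full branch of $(D_j)_{j\leqslant i}$, and $D_0$ has an element (necessarily unique). A full branch of $(D_j)_{j\in J}$ is a family $(x_j)_{j\in J}$ with $x_j\in D_j$ compatible with the connecting maps. *)

theory Defs
  imports
    "HOL-Library.Countable_Set_Type"
    "HOL-Library.FuncSet"
    "HOL-Library.Infinite_Typeclass"
begin

unbundle cardinal_syntax

section \<open>Ordinals\<close>

text \<open>The elements of the initial well-order of cardinality \<open>\<aleph>\<^sub>2\<close> serve as the ordinals below
  \<open>\<omega>\<^sub>2\<close>. This is more than enough to speak of all ordinals up to and including \<open>\<omega>\<^sub>1\<close>.\<close>

typedef ordinal = "Field (cardSuc (cardSuc natLeq))"
proof -
  have "Card_order (cardSuc (cardSuc natLeq))" "infinite (Field (cardSuc (cardSuc natLeq)))"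
    using natLeq_Cinfinite Cinfinite_cardSuc[OF Cinfinite_cardSuc]
    by (auto simp: cinfinite_def)
  then show ?thesis by (metis all_not_in_conv finite.emptyI)
qed

instantiation ordinal :: wellorder
begin

definition less_eq_ordinal :: "ordinal \<Rightarrow> ordinal \<Rightarrow> bool" where
  "(i :: ordinal) \<le> j \<longleftrightarrow> (Rep_ordinal i, Rep_ordinal j) \<in> cardSuc (cardSuc natLeq)"

definition less_ordinal :: "ordinal \<Rightarrow> ordinal \<Rightarrow> bool" where
  "(i :: ordinal) < j \<longleftrightarrow> i \<le> j \<and> i \<noteq> j"

instance
proof -
  let ?r = "cardSuc (cardSuc natLeq)"
  have wo: "Well_order ?r"
    using natLeq_Cinfinite Cinfinite_cardSuc[OF Cinfinite_cardSuc]
    by (metis card_order_on_well_order_on)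
  have R: "Refl ?r" and T: "trans ?r" and A: "antisym ?r" and To: "Total ?r" and W: "wf (?r - Id)"
    using wo by (auto simp: order_on_defs)
  show "OFCLASS(ordinal, wellorder_class)"
  proof
    fix x y z :: ordinal
    show "x \<le> x" using R Rep_ordinal[of x] by (auto simp: less_eq_ordinal_def refl_on_def)
    show "x \<le> y \<Longrightarrow> y \<le> z \<Longrightarrow> x \<le> z" using T by (meson less_eq_ordinal_def transD)
    show anti: "x \<le> y \<Longrightarrow> y \<le> x \<Longrightarrow> x = y" using A
      by (metis Rep_ordinal_inject less_eq_ordinal_def antisymD)
    show "(x < y) = (x \<le> y \<and> \<not> y \<le> x)"
      using A R Rep_ordinal[of x]
      by (metis Rep_ordinal_inject less_eq_ordinal_def less_ordinal_def antisymD refl_onD)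
    show "x \<le> y \<or> y \<le> x"
      using To R Rep_ordinal[of x] Rep_ordinal[of y]
      by (metis less_eq_ordinal_def refl_onD total_on_def)
  next
    fix P :: "ordinal \<Rightarrow> bool" and a :: ordinal
    assume H: "\<And>x. (\<And>y. y < x \<Longrightarrow> P y) \<Longrightarrow> P x"
    have "wf (inv_image (?r - Id) Rep_ordinal)" using W by (rule wf_inv_image)
    then show "P a"
    proof (induction a rule: wf_induct_rule)
      case (less x)
      show ?case
        by (rule H, rule less)
          (auto simp: less_ordinal_def less_eq_ordinal_def Rep_ordinal_inject)
    qed
  qed
qed

end

instantiation ordinal :: zero
begin
definition zero_ordinal :: ordinal where "(0 :: ordinal) = (LEAST i. True)"
instance ..
end

definition osuc :: "ordinal \<Rightarrow> ordinal" where
  "osuc i = (LEAST j. i < j)"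

definition opred :: "ordinal \<Rightarrow> ordinal" where
  "opred i = (THE j. i = osuc j)"

text \<open>Here \<open>0\<close> counts as a limit.\<close>

definition limit_ord :: "ordinal \<Rightarrow> bool" where
  "limit_ord i \<longleftrightarrow> (\<nexists>j. i = osuc j)"

definition omega1 :: ordinal  ("\<omega>\<^sub>1") where
  "\<omega>\<^sub>1 = (LEAST i. uncountable {..<i})"

lemma zero_le_ordinal: "0 \<le> (i :: ordinal)"
  by (simp add: zero_ordinal_def Least_le)

lemma ex_greater_ordinal: "\<exists>j. (i :: ordinal) < j"
proof -
  have "Cinfinite (cardSuc (cardSuc natLeq))"
    by (intro Cinfinite_cardSuc natLeq_Cinfinite)
  then obtain b where "b \<in> Field (cardSuc (cardSuc natLeq))" "Rep_ordinal i \<noteq> b"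
      "(Rep_ordinal i, b) \<in> cardSuc (cardSuc natLeq)"
    using infinite_Card_order_limit[OF _ _ Rep_ordinal[of i]] unfolding cinfinite_def by blast
  then have "i < Abs_ordinal b"
    by (auto simp: less_ordinal_def less_eq_ordinal_def Abs_ordinal_inverse)
  then show ?thesis ..
qed

lemma less_osuc: "i < osuc i"
  unfolding osuc_def using ex_greater_ordinal by (rule LeastI_ex)

lemma less_osuc_iff: "j < osuc i \<longleftrightarrow> j \<le> i"
  using less_osuc[of i] not_less_Least[of j "\<lambda>j. i < j"] unfolding osuc_def by fastforce

lemma osuc_inject: "osuc i = osuc j \<longleftrightarrow> i = j"
  by (metis less_osuc less_osuc_iff order.antisym)

lemma osuc_less_osuc: "osuc i < osuc j \<longleftrightarrow> i < j"
  by (metis leD leI less_osuc less_osuc_iff order.strict_trans1 order.strict_trans2)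

lemma opred_osuc: "opred (osuc i) = i"
  by (simp add: opred_def osuc_inject)

lemma not_limit_osuc: "\<not> limit_ord (osuc i)"
  by (auto simp: limit_ord_def)

lemma opred_less: "\<not> limit_ord i \<Longrightarrow> opred i < i"
  by (auto simp: limit_ord_def opred_osuc less_osuc)

lemma limit_zero: "limit_ord 0"
  by (metis leD less_osuc limit_ord_def zero_le_ordinal)

lemma ex_uncountable_below: "\<exists>i :: ordinal. uncountable {..<i}"
proof -
  let ?k = "cardSuc natLeq" and ?r = "cardSuc (cardSuc natLeq)"
  have ck: "Cinfinite ?k" and cr: "Cinfinite ?r"
    by (intro Cinfinite_cardSuc natLeq_Cinfinite)+
  have wk: "Well_order ?k" and wr: "Well_order ?r"
    using ck cr card_order_on_well_order_on by blast+
  have "?k <o ?r" using ck cardSuc_greater by blast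
  then obtain a where a: "a \<in> Field ?r" "?k =o Restr ?r (underS ?r a)"
    using ordLess_iff_ordIso_Restr[OF wr wk] by auto
  have unc: "uncountable (Field ?k)"
  proof
    assume "countable (Field ?k)"
    then have "|Field ?k| \<le>o natLeq" by (simp add: countable_card_le_natLeq)
    moreover have "|Field ?k| =o ?k" using ck card_of_Field_ordIso by blast
    moreover have "natLeq <o ?k" using natLeq_Card_order cardSuc_greater by blast
    ultimately show False
      by (meson not_ordLess_ordLeq ordIso_ordLeq_trans ordIso_symmetric)
  qed
  obtain f where f: "iso ?k (Restr ?r (underS ?r a)) f" using a(2) unfolding ordIso_def by auto
  have "bij_betw f (Field ?k) (Field (Restr ?r (underS ?r a)))"
    using f by (simp add: iso_def)
  then have "uncountable (Field (Restr ?r (underS ?r a)))"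
    using unc bij_betw_def countable_image_inj_on by metis
  moreover have "Field (Restr ?r (underS ?r a)) \<subseteq> Rep_ordinal ` {..<Abs_ordinal a}"
  proof
    fix x assume "x \<in> Field (Restr ?r (underS ?r a))"
    then have x: "x \<noteq> a" "(x, a) \<in> ?r" by (auto simp: Field_def underS_def)
    then have xF: "x \<in> Field ?r" by (auto simp: Field_def)
    have "Abs_ordinal x < Abs_ordinal a"
      using x xF a(1)
      by (auto simp: less_ordinal_def less_eq_ordinal_def Abs_ordinal_inverse Abs_ordinal_inject)
    then show "x \<in> Rep_ordinal ` {..<Abs_ordinal a}"
      using xF by (metis Abs_ordinal_inverse imageI lessThan_iff)
  qed
  ultimately have "uncountable {..<Abs_ordinal a}" using countable_image countable_subset by blast
  then show ?thesis ..
qed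

lemma uncountable_below_omega1: "uncountable {..<\<omega>\<^sub>1}"
  unfolding omega1_def using ex_uncountable_below by (rule LeastI_ex)

lemma countable_below: "i < \<omega>\<^sub>1 \<Longrightarrow> countable {..<i}"
  unfolding omega1_def by (metis not_less_Least)

lemma limit_omega1: "limit_ord \<omega>\<^sub>1"
  unfolding limit_ord_def
proof
  assume "\<exists>j. \<omega>\<^sub>1 = osuc j"
  then obtain j where j: "\<omega>\<^sub>1 = osuc j" ..
  then have "{..<\<omega>\<^sub>1} = insert j {..<j}" using less_osuc_iff[of _ j] by fastforce
  moreover have "countable {..<j}" using less_osuc[of j] countable_below[of j] unfolding j[symmetric] by blast
  ultimately show False using uncountable_below_omega1 by simp
qed


section \<open>The final chain of the countable powerset functor\<close>

text \<open>A universe for all stages of the chain: an element of a successor stage is a countable set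
  of elements of the preceding stage, an element of a limit stage is a family.
  Thus \<open>nu (osuc i)\<close> below is the set of countable subsets of \<open>nu i\<close>, tagged with \<open>CSet\<close>.
  Families indexed by \<open>{..<i}\<close> are extensional functions, i.e. \<open>undefined\<close> outside \<open>{..<i}\<close>.\<close>

datatype elt = CSet (members: "elt cset") | Family (component: "ordinal \<Rightarrow> elt")

lemma restrict_fundef_cong [fundef_cong]:
  "I = J \<Longrightarrow> (\<And>i. i \<in> J \<Longrightarrow> f i = g i) \<Longrightarrow> restrict f I = restrict g J"
  by (auto simp: restrict_def)

lemma PiE_fundef_cong [fundef_cong]:
  "I = J \<Longrightarrow> (\<And>i. i \<in> J \<Longrightarrow> A i = B i) \<Longrightarrow> Pi\<^sub>E I A = Pi\<^sub>E J B"
  using PiE_cong by blast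

text \<open>The connecting map from stage \<open>i\<close> to stage \<open>j\<close>, only meaningful for \<open>j \<le> i\<close>. The case
  of a successor \<open>i\<close> and a limit \<open>j < i\<close> is forced by functoriality: for \<open>k < j\<close>, the component
  at \<open>k\<close> is the image under the connecting map from \<open>i\<close> to \<open>k\<close>.\<close>

function conn :: "ordinal \<Rightarrow> ordinal \<Rightarrow> elt \<Rightarrow> elt" where
  "conn i j x =
     (if i = j then x
      else if limit_ord i then component x j
      else if limit_ord j then Family (\<lambda>k\<in>{..<j}. conn i k x)
      else CSet (cimage (conn (opred i) (opred j)) (members x)))"
  by pat_completeness auto
termination
  by (relation "inv_image ({(i, i'). i < i'} <*lex*> {(j, j'). j < j'}) (\<lambda>(i, j, x). (i, j))")
    (auto simp: opred_less wf wf_inv_image)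

declare conn.simps [simp del]

function nu :: "ordinal \<Rightarrow> elt set" where
  "nu i =
     (if limit_ord i then
        Family ` {x \<in> \<Pi>\<^sub>E j\<in>{..<i}. nu j. \<forall>j<i. \<forall>k\<le>j. conn j k (x j) = x k}
      else CSet ` {A. rcset A \<subseteq> nu (opred i)})"
  by pat_completeness auto
termination
  by (relation "{(i, i'). i < i'}") (auto simp: opred_less wf)

declare nu.simps [simp del]

text \<open>The equations determining the chain.\<close>

lemma nu_osuc: "nu (osuc i) = CSet ` {A. rcset A \<subseteq> nu i}"
  by (subst nu.simps) (simp add: not_limit_osuc opred_osuc)

lemma nu_limit:
  "limit_ord i \<Longrightarrow>
    nu i = Family ` {x \<in> \<Pi>\<^sub>E j\<in>{..<i}. nu j. \<forall>j<i. \<forall>k\<le>j. conn j k (x j) = x k}"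
  by (subst nu.simps) simp

lemma conn_refl: "conn i i x = x"
  by (simp add: conn.simps)

lemma conn_osuc: "conn (osuc i) (osuc j) (CSet A) = CSet (cimage (conn i j) A)"
proof (cases "i = j")
  case True
  have "conn i i = id" by (simp add: conn_refl fun_eq_iff)
  then show ?thesis using True by (simp add: conn_refl cset.map_id)
next
  case False
  then show ?thesis by (subst conn.simps) (simp add: osuc_inject not_limit_osuc opred_osuc)
qed

lemma conn_limit: "limit_ord i \<Longrightarrow> j < i \<Longrightarrow> conn i j (Family x) = x j"
  by (subst conn.simps) auto

lemma conn_osuc_limit:
  assumes "limit_ord j" "j < osuc i"
  shows "conn (osuc i) j x = Family (\<lambda>k\<in>{..<j}. conn (osuc i) k x)"
  using assms by (subst conn.simps) (auto simp: not_limit_osuc)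

lemma conn_functorial:
  "x \<in> nu i \<Longrightarrow> j \<le> i \<Longrightarrow> conn i j x \<in> nu j \<and> (\<forall>k\<le>j. conn j k (conn i j x) = conn i k x)"
proof (induction i arbitrary: j x rule: less_induct)
  case (less i)
  show ?case
  proof (cases "limit_ord i")
    case True
    then obtain f where f: "x = Family f" "f \<in> (\<Pi>\<^sub>E j\<in>{..<i}. nu j)"
        "\<forall>j<i. \<forall>k\<le>j. conn j k (f j) = f k"
      using less.prems nu_limit by auto
    show ?thesis
    proof (cases "j = i")
      case True
      then show ?thesis using less.prems by (simp add: conn_refl)
    next
      case False
      then have "j < i" using less.prems by simp
      then show ?thesis using f \<open>limit_ord i\<close> by (auto simp: conn_limit)
    qed
  next
    case False
    then obtain m where m: "i = osuc m" by (auto simp: limit_ord_def)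
    then obtain A where A: "x = CSet A" "rcset A \<subseteq> nu m"
      using less.prems nu_osuc by auto
    have IH: "conn m n y \<in> nu n \<and> (\<forall>k\<le>n. conn n k (conn m n y) = conn m k y)"
      if "y \<in> rcset A" "n \<le> m" for y n
      using less.IH[of m y n] that A(2) m less_osuc by auto
    show ?thesis
      using \<open>j \<le> i\<close>
    proof (induction j rule: less_induct)
      case inner: (less j)
      consider "j = i" | "j < i" "limit_ord j" | n where "j = osuc n" "n < m"
        using inner.prems m osuc_less_osuc unfolding limit_ord_def
        by (metis order.not_eq_order_implies_strict)
      then show ?case
      proof cases
        case 1
        then show ?thesis using less.prems by (simp add: conn_refl)
      next
        case 2
        then have eq: "conn i j x = Family (\<lambda>k\<in>{..<j}. conn i k x)"
          using m conn_osuc_limit by simp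
        have "conn i j x \<in> nu j"
          unfolding eq nu_limit[OF 2(2)]
          using inner.IH 2 by (intro imageI CollectI) (auto split: if_splits)
        moreover have "conn j k (conn i j x) = conn i k x" if "k \<le> j" for k
          using that 2 eq by (cases "k = j") (auto simp: conn_refl conn_limit)
        ultimately show ?thesis by blast
      next
        case 3
        have eq: "conn i j x = CSet (cimage (conn m n) A)"
          using 3 m A conn_osuc by simp
        have "conn i j x \<in> nu j"
          unfolding eq unfolding 3(1) nu_osuc
          using 3 IH by (intro imageI CollectI) (auto simp: cset.set_map)
        moreover have "conn j k (conn i j x) = conn i k x" if "k \<le> j" for k
          using that
        proof (induction k rule: less_induct)
          case k: (less k)
          consider "k = j" | "k < j" "limit_ord k" | l where "k = osuc l" "l < n"
            using k.prems 3 osuc_less_osuc unfolding limit_ord_def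
            by (metis order.not_eq_order_implies_strict)
          then show ?case
          proof cases
            case 1
            then show ?thesis by (simp add: conn_refl)
          next
            case k2: 2
            have "k < osuc m" using k2 inner.prems m by simp
            then show ?thesis
              using k2 3 m k.IH by (auto simp: conn_osuc_limit intro!: restrict_ext)
          next
            case k3: 3
            have "conn n l (conn m n y) = conn m l y" if "y \<in> rcset A" for y
              using IH[OF that, of n] 3 k3 by simp
            then have "cimage (conn n l) (cimage (conn m n) A) = cimage (conn m l) A"
              by (auto simp: cset.map_comp intro!: cset.map_cong0)
            then show ?thesis using 3 k3 m A by (simp add: conn_osuc)
          qed
        qed
        ultimately show ?thesis by blast
      qed
    qed
  qed
qed

lemma conn_component:
  "x \<in> nu i \<Longrightarrow> limit_ord i \<Longrightarrow> j < i \<Longrightarrow> conn i j x = component x j"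
  by (auto simp: nu_limit conn_limit)

text \<open>Only meaningful for limit \<open>i\<close>, when \<open>a\<close> and \<open>b\<close> are families.\<close>

definition successor :: "ordinal \<Rightarrow> elt \<Rightarrow> elt \<Rightarrow> bool" where
  "successor i a b \<longleftrightarrow> a \<in> nu i \<and> b \<in> nu i \<and>
     (\<forall>j<i. component b j \<in> rcset (members (component a (osuc j))))"


section \<open>Trees\<close>

text \<open>A tree is given by its levels \<open>D i\<close> and its connecting maps \<open>d i j\<close> from \<open>D i\<close> to \<open>D j\<close>
  for \<open>j \<le> i < \<omega>\<^sub>1\<close>; the values of \<open>D\<close> and \<open>d\<close> elsewhere are irrelevant.
  The levels are subsets of an ambient type; they need not be disjoint.\<close>

definition full_branches ::
  "(ordinal \<Rightarrow> 't set) \<Rightarrow> (ordinal \<Rightarrow> ordinal \<Rightarrow> 't \<Rightarrow> 't) \<Rightarrow> ordinal set \<Rightarrow> (ordinal \<Rightarrow> 't) set"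
where
  "full_branches D d J = {x \<in> \<Pi>\<^sub>E j\<in>J. D j. \<forall>j\<in>J. \<forall>k\<in>J. k \<le> j \<longrightarrow> d j k (x j) = x k}"

definition tidy_tree :: "(ordinal \<Rightarrow> 't set) \<Rightarrow> (ordinal \<Rightarrow> ordinal \<Rightarrow> 't \<Rightarrow> 't) \<Rightarrow> bool" where
  "tidy_tree D d \<longleftrightarrow>
     (\<forall>i<\<omega>\<^sub>1. \<forall>j\<le>i. d i j \<in> D i \<rightarrow> D j) \<and>
     (\<forall>i<\<omega>\<^sub>1. \<forall>x\<in>D i. d i i x = x) \<and>
     (\<forall>i<\<omega>\<^sub>1. \<forall>j\<le>i. \<forall>k\<le>j. \<forall>x\<in>D i. d j k (d i j x) = d i k x) \<and>
     (\<forall>i<\<omega>\<^sub>1. \<forall>j\<le>i. d i j ` D i = D j) \<and>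
     (\<forall>i<\<omega>\<^sub>1. limit_ord i \<longrightarrow>
        (\<forall>x\<in>full_branches D d {..<i}.
           \<exists>\<^sub>\<le>\<^sub>1 y. y \<in> full_branches D d {..i} \<and> restrict y {..<i} = x)) \<and>
     D 0 \<noteq> {}"

end

theory Submission
  imports Defs
begin

text \<open>For an element \<open>a\<close> of \<open>nu \<omega>\<^sub>1\<close>, the sets \<open>a\<^sub>i\<^sub>+\<^sub>1\<close> are the levels of a tidy tree whose full
  branches are the successors of \<open>a\<close>, unless they are empty; in that case an Aronszajn tree
  serves instead.

  Conversely, number the nodes of a tree with countable levels injectively by countable ordinals
  and code a node, or a full branch, by the set of numbers of the nodes below or on it. Subsets of
  \<open>\<omega>\<^sub>1\<close> embed in the final chain, since distinct ordinals are distinct as well-founded transition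
  systems: stage \<open>k\<close> of the chain reveals (up to an offset of one) the intersection of the set with
  \<open>k\<close>. Let \<open>a\<^sub>k\<^sub>+\<^sub>1\<close> consist of the stage-\<open>k\<close> codes of all nodes of a level so high that no node above
  it has a number less than \<open>k\<close>.\<close>

section \<open>Countable ordinals\<close>

lemma osuc_le_iff: "osuc j \<le> i \<longleftrightarrow> j < i"
  by (meson less_osuc_iff not_le)

lemma osuc_less_limit: "limit_ord i \<Longrightarrow> j < i \<Longrightarrow> osuc j < i"
  by (metis limit_ord_def order.not_eq_order_implies_strict osuc_le_iff)

lemma osuc_less_omega1: "i < \<omega>\<^sub>1 \<Longrightarrow> osuc i < \<omega>\<^sub>1"
  using limit_omega1 by (rule osuc_less_limit)

lemma ordinal_cases:
  obtains (limit) "limit_ord i" | (osuc) m where "i = osuc m"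
  unfolding limit_ord_def by blast

text \<open>Regularity of \<open>\<omega>\<^sub>1\<close>: an unbounded \<open>B\<close> would cover
  it by countably many countable segments.\<close>

lemma countable_bounded:
  assumes "countable B" "B \<subseteq> {..<\<omega>\<^sub>1}"
  shows "\<exists>a<\<omega>\<^sub>1. B \<subseteq> {..<a}"
proof (rule ccontr)
  assume "\<not> ?thesis"
  then have "\<exists>b\<in>B. a \<le> b" if "a < \<omega>\<^sub>1" for a
    using that by (meson leI lessThan_iff subsetI)
  then have "{..<\<omega>\<^sub>1} \<subseteq> (\<Union>b\<in>B. {..<osuc b})"
    by (auto simp: less_osuc_iff)
  moreover have "countable (\<Union>b\<in>B. {..<osuc b})"
    using assms osuc_less_omega1 countable_below by (intro countable_UN) auto
  ultimately show False
    using uncountable_below_omega1 countable_subset by blast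
qed

section \<open>Tidy trees\<close>

text \<open>The top node of a full branch of \<open>{..i}\<close> determines the rest, so uniqueness
  of extensions at a limit reduces to \<open>sep\<close>, a condition on nodes.\<close>

lemma tidy_treeI:
  assumes map: "\<And>i j x. i < \<omega>\<^sub>1 \<Longrightarrow> j \<le> i \<Longrightarrow> x \<in> D i \<Longrightarrow> d i j x \<in> D j"
    and id: "\<And>i x. i < \<omega>\<^sub>1 \<Longrightarrow> x \<in> D i \<Longrightarrow> d i i x = x"
    and comp: "\<And>i j k x. i < \<omega>\<^sub>1 \<Longrightarrow> j \<le> i \<Longrightarrow> k \<le> j \<Longrightarrow> x \<in> D i \<Longrightarrow> d j k (d i j x) = d i k x"
    and surj: "\<And>i j y. i < \<omega>\<^sub>1 \<Longrightarrow> j \<le> i \<Longrightarrow> y \<in> D j \<Longrightarrow> \<exists>x\<in>D i. d i j x = y"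
    and sep: "\<And>i x y. i < \<omega>\<^sub>1 \<Longrightarrow> limit_ord i \<Longrightarrow> x \<in> D i \<Longrightarrow> y \<in> D i \<Longrightarrow>
      (\<And>j. j < i \<Longrightarrow> d i j x = d i j y) \<Longrightarrow> x = y"
    and "D 0 \<noteq> {}"
  shows "tidy_tree D d"
  unfolding tidy_tree_def
proof (intro conjI allI impI ballI)
  fix i x assume i: "i < \<omega>\<^sub>1" "limit_ord i" and "x \<in> full_branches D d {..<i}"
  show "\<exists>\<^sub>\<le>\<^sub>1 y. y \<in> full_branches D d {..i} \<and> restrict y {..<i} = x"
  proof (rule Uniq_I, elim conjE)
    fix y z
    assume y: "y \<in> full_branches D d {..i}" "restrict y {..<i} = x"
      and z: "z \<in> full_branches D d {..i}" "restrict z {..<i} = x"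
    have below: "y j = z j" if "j < i" for j
      using y(2) z(2) that by (metis lessThan_iff restrict_apply')
    have node: "b i \<in> D i" "j \<le> i \<Longrightarrow> d i j (b i) = b j" if "b \<in> full_branches D d {..i}" for b j
      using that unfolding full_branches_def by blast+
    have "y i = z i"
      using node[OF y(1)] node[OF z(1)] below by (simp add: sep[OF i])
    then have "y j = z j" if "j \<le> i" for j
      using below that by (cases "j = i") auto
    then show "y = z"
      using y(1) z(1) by (intro PiE_ext[of _ "{..i}" D]) (auto simp: full_branches_def)
  qed
next
  fix i j assume "i < \<omega>\<^sub>1" "j \<le> (i::ordinal)"
  then show "d i j ` D i = D j" using map surj by blast
qed (use assms in auto)

lemma full_branches_node:
  assumes "tidy_tree D d" "i < \<omega>\<^sub>1" "x \<in> D i" "J \<subseteq> {..i}"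
  shows "(\<lambda>j\<in>J. d i j x) \<in> full_branches D d J"
proof -
  have "d i j x \<in> D j" if "j \<in> J" for j
    using assms that unfolding tidy_tree_def by blast
  moreover have "d j k (d i j x) = d i k x" if "j \<in> J" "k \<le> j" for j k
    using assms that unfolding tidy_tree_def by blast
  ultimately show ?thesis by (simp add: full_branches_def)
qed

text \<open>The projections of \<open>x\<close> and of \<open>y\<close> form two extensions of the
  same branch below \<open>i\<close>, hence coincide.\<close>

lemma tidy_tree_separated:
  assumes T: "tidy_tree D d" and i: "i < \<omega>\<^sub>1" "limit_ord i" and xy: "x \<in> D i" "y \<in> D i"
    and eq: "\<And>j. j < i \<Longrightarrow> d i j x = d i j y"
  shows "x = y"
proof -
  let ?b = "\<lambda>z. \<lambda>j\<in>{..i}. d i j z"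
  have r: "restrict (?b z) {..<i} = (\<lambda>j\<in>{..<i}. d i j z)" for z
    by (auto simp: fun_eq_iff)
  have "(\<lambda>j\<in>{..<i}. d i j x) \<in> full_branches D d {..<i}"
    using T i(1) xy(1) by (rule full_branches_node) auto
  then have "\<exists>\<^sub>\<le>\<^sub>1 b. b \<in> full_branches D d {..i} \<and> restrict b {..<i} = (\<lambda>j\<in>{..<i}. d i j x)"
    using T i unfolding tidy_tree_def by blast
  moreover have "?b x \<in> full_branches D d {..i} \<and> restrict (?b x) {..<i} = (\<lambda>j\<in>{..<i}. d i j x)"
    using full_branches_node[OF T i(1) xy(1), of "{..i}"] r by simp
  moreover have "?b y \<in> full_branches D d {..i} \<and> restrict (?b y) {..<i} = (\<lambda>j\<in>{..<i}. d i j x)"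
    using full_branches_node[OF T i(1) xy(2), of "{..i}"] r eq by (auto intro!: restrict_ext)
  ultimately have "?b x = ?b y"
    unfolding Uniq_def by blast
  then have "?b x i = ?b y i" by simp
  then show ?thesis using T i xy by (simp add: tidy_tree_def)
qed

lemma tidy_tree_nonempty:
  assumes "tidy_tree D d" "i < \<omega>\<^sub>1"
  shows "D i \<noteq> {}"
proof -
  have "d i 0 ` D i = D 0" "D 0 \<noteq> {}"
    using assms by (auto simp: tidy_tree_def zero_le_ordinal)
  then show ?thesis by auto
qed

text \<open>The trees constructed have nodes of particular types, whereas the theorem allows any
  infinite one. Levels are countable and may overlap, so a single copy of \<open>nat\<close> in
  \<open>'t\<close> holds them all.\<close>

lemma tidy_tree_transfer:
  fixes D :: "ordinal \<Rightarrow> 's set" and lam :: "'l rel"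
  assumes T: "tidy_tree D d" and cnt: "\<And>i. i < \<omega>\<^sub>1 \<Longrightarrow> countable (D i)"
    and card: "|full_branches D d {..<\<omega>\<^sub>1}| =o lam"
  shows "\<exists>(D' :: ordinal \<Rightarrow> 't::infinite set) d'. tidy_tree D' d' \<and> (\<forall>i<\<omega>\<^sub>1. countable (D' i)) \<and>
    |full_branches D' d' {..<\<omega>\<^sub>1}| =o lam"
proof -
  obtain e :: "nat \<Rightarrow> 't" where e: "inj e"
    using infinite_UNIV infinite_countable_subset by blast
  define f where "f i = e \<circ> to_nat_on (D i)" for i
  define g where "g i = inv_into (D i) (f i)" for i
  have "inj_on (f i) (D i)" if "i < \<omega>\<^sub>1" for i
    unfolding f_def using that cnt e by (intro comp_inj_on) (auto intro: inj_on_subset)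
  then have gf: "g i (f i x) = x" if "i < \<omega>\<^sub>1" "x \<in> D i" for i x
    unfolding g_def using that by (intro inv_into_f_f)
  define D' where "D' i = f i ` D i" for i
  define d' where "d' i j y = f j (d i j (g i y))" for i j y
  have map: "d i j x \<in> D j" if "i < \<omega>\<^sub>1" "j \<le> i" "x \<in> D i" for i j x
    using T that by (auto simp: tidy_tree_def)
  have surj: "\<exists>x\<in>D i. d i j x = y" if "i < \<omega>\<^sub>1" "j \<le> i" "y \<in> D j" for i j y
  proof -
    have "y \<in> d i j ` D i" using T that by (simp add: tidy_tree_def)
    then show ?thesis by auto
  qed
  have d'f: "d' i j (f i x) = f j (d i j x)" if "i < \<omega>\<^sub>1" "x \<in> D i" for i j x
    using that by (simp add: d'_def gf)
  have T': "tidy_tree D' d'"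
  proof (rule tidy_treeI)
    fix i x y assume i: "i < \<omega>\<^sub>1" "limit_ord i" and xy: "x \<in> D' i" "y \<in> D' i"
      and eq: "\<And>j. j < i \<Longrightarrow> d' i j x = d' i j y"
    obtain u v where uv: "x = f i u" "u \<in> D i" "y = f i v" "v \<in> D i"
      using xy by (auto simp: D'_def)
    have "d i j u = d i j v" if "j < i" for j
      using eq[OF that] uv i that d'f gf map by (metis order.strict_implies_order order.strict_trans)
    then have "u = v" using tidy_tree_separated[OF T i] uv by blast
    then show "x = y" using uv by simp
  next
    fix i j y assume ij: "i < \<omega>\<^sub>1" "j \<le> i" and "y \<in> D' j"
    then obtain v where "y = f j v" "v \<in> D j" by (auto simp: D'_def)
    moreover obtain u where "u \<in> D i" "d i j u = v" using surj ij \<open>v \<in> D j\<close> by blast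
    ultimately show "\<exists>x\<in>D' i. d' i j x = y" using ij by (auto simp: D'_def d'f)
  next
    fix i j k x assume ij: "i < \<omega>\<^sub>1" "j \<le> i" "k \<le> j" and "x \<in> D' i"
    then obtain u where u: "x = f i u" "u \<in> D i" by (auto simp: D'_def)
    moreover have "d j k (d i j u) = d i k u" using T ij u by (auto simp: tidy_tree_def)
    ultimately show "d' j k (d' i j x) = d' i k x"
      using ij map[of i j u] by (simp add: d'f)
  qed (use T map in \<open>auto simp: D'_def d'f\<close>, auto simp: tidy_tree_def)
  have "bij_betw (\<lambda>X. \<lambda>i\<in>{..<\<omega>\<^sub>1}. f i (X i)) (full_branches D d {..<\<omega>\<^sub>1}) (full_branches D' d' {..<\<omega>\<^sub>1})"
  proof (rule bij_betw_byWitness[where f' = "\<lambda>Y. \<lambda>i\<in>{..<\<omega>\<^sub>1}. g i (Y i)"])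
    show "\<forall>X\<in>full_branches D d {..<\<omega>\<^sub>1}. (\<lambda>i\<in>{..<\<omega>\<^sub>1}. g i ((\<lambda>i\<in>{..<\<omega>\<^sub>1}. f i (X i)) i)) = X"
      by (auto simp: full_branches_def gf fun_eq_iff PiE_iff extensional_def)
    have fg: "f i (g i y) = y" if "i < \<omega>\<^sub>1" "y \<in> D' i" for i y
      using that by (auto simp: D'_def gf)
    show "\<forall>Y\<in>full_branches D' d' {..<\<omega>\<^sub>1}. (\<lambda>i\<in>{..<\<omega>\<^sub>1}. f i ((\<lambda>i\<in>{..<\<omega>\<^sub>1}. g i (Y i)) i)) = Y"
      by (auto simp: full_branches_def fg fun_eq_iff PiE_iff extensional_def)
    show "(\<lambda>X. \<lambda>i\<in>{..<\<omega>\<^sub>1}. f i (X i)) ` full_branches D d {..<\<omega>\<^sub>1} \<subseteq> full_branches D' d' {..<\<omega>\<^sub>1}"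
      by (auto simp: full_branches_def D'_def PiE_iff d'f)
    have gD: "g i y \<in> D i" if "i < \<omega>\<^sub>1" "y \<in> D' i" for i y
      using that by (auto simp: D'_def gf)
    have "d j k (g j y) = g k (d' j k y)" if "j < \<omega>\<^sub>1" "k \<le> j" "y \<in> D' j" for j k y
      using that map gD by (simp add: d'_def gf)
    then show "(\<lambda>Y. \<lambda>i\<in>{..<\<omega>\<^sub>1}. g i (Y i)) ` full_branches D' d' {..<\<omega>\<^sub>1} \<subseteq> full_branches D d {..<\<omega>\<^sub>1}"
      using gD by (auto simp: full_branches_def PiE_iff)
  qed
  then have "|full_branches D' d' {..<\<omega>\<^sub>1}| =o lam"
    using card card_of_ordIsoI ordIso_symmetric ordIso_transitive by blast
  then show ?thesis
    using T' cnt by (intro exI[of _ D'] exI[of _ d']) (auto simp: D'_def)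
qed

section \<open>An Aronszajn tree\<close>

text \<open>A variant of Todorcevic's function \<open>\<rho>\<^sub>1\<close>, driven by enumerations of the countable ordinals
  in place of ladder systems.\<close>

function rho :: "ordinal \<Rightarrow> ordinal \<Rightarrow> nat" where
  "rho a x =
     (if x < a then
        max (LEAST n. x \<le> from_nat_into {..<a} n)
          (rho (from_nat_into {..<a} (LEAST n. x \<le> from_nat_into {..<a} n)) x)
      else 0)"
  by pat_completeness auto
termination
proof (relation "{(i, i'). i < i'} <*lex*> {}", goal_cases)
  case (2 a x)
  then have "from_nat_into {..<a} n \<in> {..<a}" for n
    by (intro from_nat_into) auto
  then show ?case by simp
qed (auto simp: wf)

declare rho.simps [simp del]

text \<open>The least index is at most that of \<open>b\<close>, a bound independent of
  \<open>x\<close>: finitely many first steps serve all \<open>x \<le> b\<close>.\<close>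

lemma rho_less:
  assumes "a < \<omega>\<^sub>1" "x \<le> b" "b < a"
  obtains n where "n \<le> to_nat_on {..<a} b" "from_nat_into {..<a} n < a"
    "x \<le> from_nat_into {..<a} n" "rho a x = max n (rho (from_nat_into {..<a} n) x)"
proof -
  let ?P = "\<lambda>n. x \<le> from_nat_into {..<a} n"
  have P: "?P (to_nat_on {..<a} b)"
    using assms countable_below by simp
  have "from_nat_into {..<a} (Least ?P) \<in> {..<a}"
    using assms by (intro from_nat_into) auto
  moreover have "rho a x = max (Least ?P) (rho (from_nat_into {..<a} (Least ?P)) x)"
    using order.strict_trans1[OF assms(2,3)] by (subst rho.simps) simp
  ultimately show ?thesis
    using that[of "Least ?P"] LeastI[of ?P, OF P] Least_le[of ?P, OF P] by auto
qed

text \<open>If \<open>x < a\<close> and \<open>rho a x \<le> m\<close>, the first step has index at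
  most \<open>m\<close> and its target \<open>c\<close> again satisfies
  \<open>rho c x \<le> m\<close>; induction applies to each of the finitely many targets.\<close>

lemma finite_rho_le: "a < \<omega>\<^sub>1 \<Longrightarrow> finite {x. x \<le> a \<and> rho a x \<le> m}"
proof (induction a rule: less_induct)
  case (less a)
  let ?s = "from_nat_into {..<a}"
  have "{x. x \<le> a \<and> rho a x \<le> m} \<subseteq>
    insert a (\<Union>n\<in>{n. n \<le> m \<and> ?s n < a}. {x. x \<le> ?s n \<and> rho (?s n) x \<le> m})"
  proof
    fix x assume x: "x \<in> {x. x \<le> a \<and> rho a x \<le> m}"
    show "x \<in> insert a (\<Union>n\<in>{n. n \<le> m \<and> ?s n < a}. {x. x \<le> ?s n \<and> rho (?s n) x \<le> m})"
    proof (cases "x = a")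
      case False
      then have "x < a" using x order.not_eq_order_implies_strict by blast
      then obtain n where "?s n < a" "x \<le> ?s n" "rho a x = max n (rho (?s n) x)"
        using rho_less[OF less.prems, of x x] by auto
      then show ?thesis using x by auto
    qed simp
  qed
  moreover have "finite {x. x \<le> ?s n \<and> rho (?s n) x \<le> m}" if "?s n < a" for n
    using less that by auto
  ultimately show ?case by (auto intro: finite_subset)
qed

text \<open>For \<open>x \<le> b < a\<close> only finitely many first steps \<open>n\<close> occur.
  Taking \<open>max\<close> with \<open>n\<close> changes the value at the target only where it is
  at most \<open>n\<close>, so finitely often; the target and \<open>b\<close> are compared by
  induction at the larger of the two.\<close>

lemma rho_coherent: "b \<le> a \<Longrightarrow> a < \<omega>\<^sub>1 \<Longrightarrow> finite {x. x \<le> b \<and> rho a x \<noteq> rho b x}"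
proof (induction a arbitrary: b rule: less_induct)
  case (less a)
  let ?s = "from_nat_into {..<a}"
  show ?case
  proof (cases "b = a")
    case False
    then have b: "b < a" using less by simp
    let ?N = "to_nat_on {..<a} b"
    let ?L = "\<lambda>n. {x. x \<le> ?s n \<and> rho (?s n) x \<le> n}"
    let ?E = "\<lambda>n. {x. x \<le> min (?s n) b \<and> rho (?s n) x \<noteq> rho b x}"
    have "{x. x \<le> b \<and> rho a x \<noteq> rho b x} \<subseteq> (\<Union>n\<in>{n. n \<le> ?N \<and> ?s n < a}. ?L n \<union> ?E n)"
    proof
      fix x assume x: "x \<in> {x. x \<le> b \<and> rho a x \<noteq> rho b x}"
      then obtain n where "n \<le> ?N" "?s n < a" "x \<le> ?s n" "rho a x = max n (rho (?s n) x)"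
        using rho_less[OF \<open>a < \<omega>\<^sub>1\<close> _ b, of x] by auto
      then show "x \<in> (\<Union>n\<in>{n. n \<le> ?N \<and> ?s n < a}. ?L n \<union> ?E n)"
        using x by (cases "rho (?s n) x \<le> n") auto
    qed
    moreover have "finite (?L n)" if "?s n < a" for n
      using finite_rho_le that less.prems by auto
    moreover have "finite (?E n)" if "?s n < a" for n
    proof (cases "?s n \<le> b")
      case True
      have "?E n = {x. x \<le> ?s n \<and> rho b x \<noteq> rho (?s n) x}"
        using True by auto
      then show ?thesis using less.IH[OF b True] b less.prems by auto
    next
      case False
      then show ?thesis using less.IH[OF that, of b] that less.prems by (auto simp: min_def)
    qed
    ultimately show ?thesis by (auto intro: finite_subset)
  qed simp
qed

definition aronszajn_level :: "ordinal \<Rightarrow> (ordinal \<Rightarrow> nat) set" where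
  "aronszajn_level i = {f \<in> extensional {..<i}. finite {x. x < i \<and> f x \<noteq> rho i x}}"

definition aronszajn_map :: "ordinal \<Rightarrow> ordinal \<Rightarrow> (ordinal \<Rightarrow> nat) \<Rightarrow> ordinal \<Rightarrow> nat" where
  "aronszajn_map i j f = restrict f {..<j}"

lemma aronszajn_tidy: "tidy_tree aronszajn_level aronszajn_map"
proof (rule tidy_treeI)
  fix i j f assume ij: "i < \<omega>\<^sub>1" "j \<le> i" and f: "f \<in> aronszajn_level i"
  have "{x. x < j \<and> f x \<noteq> rho j x} \<subseteq> {x. x < i \<and> f x \<noteq> rho i x} \<union> {x. x \<le> j \<and> rho i x \<noteq> rho j x}"
    using ij by auto
  moreover have "finite {x. x < i \<and> f x \<noteq> rho i x}"
    using f by (simp add: aronszajn_level_def)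
  ultimately have "finite {x. x < j \<and> f x \<noteq> rho j x}"
    using rho_coherent[OF ij(2,1)] by (meson finite_UnI finite_subset)
  then show "aronszajn_map i j f \<in> aronszajn_level j"
    by (auto simp: aronszajn_map_def aronszajn_level_def elim!: rev_finite_subset)
next
  fix i j f assume ij: "i < \<omega>\<^sub>1" "j \<le> i" and f: "f \<in> aronszajn_level j"
  \<comment> \<open>\<open>f\<close> is prolonged by the values of \<open>rho i\<close>; coherence
    keeps the deviations below \<open>j\<close> finite.\<close>
  let ?g = "\<lambda>x\<in>{..<i}. if x < j then f x else rho i x"
  have "{x. x < i \<and> ?g x \<noteq> rho i x} \<subseteq> {x. x < j \<and> f x \<noteq> rho j x} \<union> {x. x \<le> j \<and> rho i x \<noteq> rho j x}"
    by auto
  moreover have "finite {x. x < j \<and> f x \<noteq> rho j x}"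
    using f by (simp add: aronszajn_level_def)
  ultimately have "finite {x. x < i \<and> ?g x \<noteq> rho i x}"
    using rho_coherent[OF ij(2,1)] by (meson finite_UnI finite_subset)
  then have "?g \<in> aronszajn_level i" by (simp add: aronszajn_level_def)
  moreover have "aronszajn_map i j ?g = f"
    using f ij by (auto simp: aronszajn_map_def aronszajn_level_def fun_eq_iff extensional_def)
  ultimately show "\<exists>g\<in>aronszajn_level i. aronszajn_map i j g = f" by blast
next
  fix i f g
  assume i: "limit_ord i" and fg: "f \<in> aronszajn_level i" "g \<in> aronszajn_level i"
    and eq: "\<And>j. j < i \<Longrightarrow> aronszajn_map i j f = aronszajn_map i j g"
  \<comment> \<open>At a limit, the value at \<open>x\<close> is already visible in the restriction
    to \<open>osuc x\<close>.\<close>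
  have "f x = g x" if "x < i" for x
    using fun_cong[OF eq[OF osuc_less_limit[OF i that]], of x]
    by (simp add: aronszajn_map_def less_osuc)
  then show "f = g"
    using fg by (intro extensionalityI[of _ "{..<i}"]) (auto simp: aronszajn_level_def)
next
  have "restrict (rho 0) {..<0} \<in> aronszajn_level 0" by (auto simp: aronszajn_level_def)
  then show "aronszajn_level 0 \<noteq> {}" by blast
qed (auto simp: aronszajn_map_def aronszajn_level_def extensional_restrict fun_eq_iff)

text \<open>A node is determined by the finite graph of its deviations from
  \<open>rho i\<close>.\<close>

lemma countable_aronszajn_level:
  assumes "i < \<omega>\<^sub>1"
  shows "countable (aronszajn_level i)"
proof -
  let ?F = "{G. finite G \<and> G \<subseteq> {..<i} \<times> (UNIV :: nat set)}"
  let ?h = "\<lambda>G. \<lambda>x\<in>{..<i}. if \<exists>n. (x, n) \<in> G then SOME n. (x, n) \<in> G else rho i x"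
  have "aronszajn_level i \<subseteq> ?h ` ?F"
  proof
    fix f assume f: "f \<in> aronszajn_level i"
    let ?G = "(\<lambda>x. (x, f x)) ` {x. x < i \<and> f x \<noteq> rho i x}"
    have "(x, n) \<in> ?G \<longleftrightarrow> x < i \<and> f x \<noteq> rho i x \<and> n = f x" for x n by auto
    then have "f x = ?h ?G x" for x
      using f by (simp add: aronszajn_level_def extensional_def)
    then have "f = ?h ?G" by blast
    moreover have "?G \<in> ?F" using f by (auto simp: aronszajn_level_def)
    ultimately show "f \<in> ?h ` ?F" by blast
  qed
  moreover have "countable ?F"
    using countable_below[OF assms] by (intro countable_Collect_finite_subset) auto
  ultimately show ?thesis by (rule countable_subset[OF _ countable_image])
qed

text \<open>A full branch would be a map \<open>\<omega>\<^sub>1 \<rightarrow> \<nat>\<close> that is finite-to-one on every countable ordinal.\<close>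

lemma aronszajn_no_full_branch: "full_branches aronszajn_level aronszajn_map {..<\<omega>\<^sub>1} = {}"
proof (rule ccontr)
  assume "full_branches aronszajn_level aronszajn_map {..<\<omega>\<^sub>1} \<noteq> {}"
  then obtain X where "X \<in> full_branches aronszajn_level aronszajn_map {..<\<omega>\<^sub>1}" by blast
  then have X: "i < \<omega>\<^sub>1 \<Longrightarrow> X i \<in> aronszajn_level i"
      "i < \<omega>\<^sub>1 \<Longrightarrow> j \<le> i \<Longrightarrow> restrict (X i) {..<j} = X j" for i j
    by (auto simp: full_branches_def aronszajn_map_def)
  define h where "h x = X (osuc x) x" for x
  have h: "h x = X i x" if "x < i" "i < \<omega>\<^sub>1" for x i
    unfolding h_def using X(2)[of i "osuc x"] that
    by (metis less_osuc lessThan_iff osuc_le_iff restrict_apply')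
  have "\<exists>n. uncountable {x. x < \<omega>\<^sub>1 \<and> h x = n}"
  proof (rule ccontr)
    assume "\<not> ?thesis"
    then have "countable (\<Union>n. {x. x < \<omega>\<^sub>1 \<and> h x = n})" by simp
    moreover have "(\<Union>n. {x. x < \<omega>\<^sub>1 \<and> h x = n}) = {..<\<omega>\<^sub>1}" by auto
    ultimately show False using uncountable_below_omega1 by simp
  qed
  then obtain n where "uncountable {x. x < \<omega>\<^sub>1 \<and> h x = n}" ..
  \<comment> \<open>A countable infinite part of the uncountable fibre is bounded, so a single level
    \<open>i\<close> sees all of it.\<close>
  then obtain B where B: "B \<subseteq> {x. x < \<omega>\<^sub>1 \<and> h x = n}" "infinite B" "countable B"
    by (metis (no_types, lifting) infinite_countable_subset' uncountable_infinite)
  then obtain i where i: "i < \<omega>\<^sub>1" "B \<subseteq> {..<i}"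
    using countable_bounded[of B] by auto
  \<comment> \<open>Where \<open>X i\<close> agrees with \<open>rho i\<close> on \<open>B\<close>,
    the common value is \<open>n\<close>.\<close>
  have "B \<subseteq> {x. x < i \<and> X i x \<noteq> rho i x} \<union> {x. x \<le> i \<and> rho i x \<le> n}"
    using B(1) i h by fastforce
  moreover have "finite {x. x < i \<and> X i x \<noteq> rho i x}"
    using X(1)[OF i(1)] by (simp add: aronszajn_level_def)
  ultimately show False
    using finite_rho_le[OF i(1), of n] B(2) by (meson finite_UnI finite_subset)
qed

section \<open>Coding sets of ordinals in the final chain\<close>

text \<open>A set \<open>A\<close> of ordinals is viewed as a state whose successors are the states \<open>{..<k}\<close> for
  \<open>k \<in> A\<close>, and \<open>enc i A\<close> is its behaviour up to stage \<open>i\<close>. At a countable stage \<open>i\<close> all \<open>k \<ge> i\<close>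
  look alike, so only countably many successors are visible even when \<open>A\<close> is uncountable.\<close>

function enc :: "ordinal \<Rightarrow> ordinal set \<Rightarrow> elt" where
  "enc i A =
     (if limit_ord i then Family (\<lambda>k\<in>{..<i}. enc k A)
      else CSet (acset ((\<lambda>k. enc (opred i) {..<k}) ` A)))"
  by pat_completeness auto
termination
  by (relation "inv_image {(i, i'). i < i'} fst") (auto simp: opred_less wf wf_inv_image)

declare enc.simps [simp del]

lemma enc_limit: "limit_ord i \<Longrightarrow> enc i A = Family (\<lambda>k\<in>{..<i}. enc k A)"
  by (subst enc.simps) simp

lemma enc_osuc: "enc (osuc i) A = CSet (acset ((\<lambda>k. enc i {..<k}) ` A))"
  by (subst enc.simps) (simp add: not_limit_osuc opred_osuc)

text \<open>By induction all successors \<open>{..<l}\<close> with \<open>m \<le> l\<close> look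
  alike at stage \<open>m\<close>, so every ordinal above \<open>m\<close> shows the same set at
  stage \<open>osuc m\<close>; limit stages are componentwise.\<close>

lemma enc_stable: "i \<le> k \<Longrightarrow> enc i {..<k} = enc i {..<i}"
proof (induction i arbitrary: k rule: less_induct)
  case (less i)
  show ?case
  proof (cases i rule: ordinal_cases)
    case limit
    have "enc j {..<k} = enc j {..<i}" if "j < i" for j
      using less.IH[OF that, of k] less.IH[OF that, of i] that less.prems by simp
    then show ?thesis by (auto simp: enc_limit[OF limit] intro!: restrict_ext)
  next
    case (osuc m)
    have "enc m {..<l} = enc m {..<m}" if "m \<le> l" for l
      using less.IH[of m l] that by (simp add: osuc less_osuc)
    then have "(\<lambda>l. enc m {..<l}) ` {..<n} = (\<lambda>l. enc m {..<l}) ` {..m}" if "m < n" for n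
    proof (intro equalityI image_subsetI)
      fix l
      show "enc m {..<l} \<in> (\<lambda>l. enc m {..<l}) ` {..m}"
        using \<open>m \<le> l \<Longrightarrow> enc m {..<l} = enc m {..<m}\<close> by (cases "l \<le> m") auto
    next
      fix l assume "l \<in> {..m}"
      then show "enc m {..<l} \<in> (\<lambda>l. enc m {..<l}) ` {..<n}" using that by auto
    qed
    then show ?thesis
      using less.prems less_osuc by (simp add: osuc enc_osuc osuc_le_iff)
  qed
qed

text \<open>By \<open>enc_stable\<close>, \<open>k\<close> may be replaced by
  \<open>min i k\<close>. Countability is what makes the use of \<open>acset\<close> in
  \<open>enc\<close> faithful.\<close>

lemma countable_enc_image:
  assumes "i < \<omega>\<^sub>1"
  shows "countable ((\<lambda>k. enc i {..<k}) ` A)"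
proof (rule countable_subset)
  show "(\<lambda>k. enc i {..<k}) ` A \<subseteq> (\<lambda>k. enc i {..<k}) ` {..<osuc i}"
  proof clarify
    fix k
    have "enc i {..<k} = enc i {..<min i k}"
      by (cases "i \<le> k") (auto simp: enc_stable[of i k] min_def)
    then show "enc i {..<k} \<in> (\<lambda>k. enc i {..<k}) ` {..<osuc i}"
      by (intro image_eqI[of _ _ "min i k"]) (auto simp: less_osuc_iff)
  qed
  show "countable ((\<lambda>k. enc i {..<k}) ` {..<osuc i})"
    using assms osuc_less_omega1 countable_below by blast
qed

lemma rcset_enc: "i < \<omega>\<^sub>1 \<Longrightarrow> rcset (members (enc (osuc i) A)) = (\<lambda>k. enc i {..<k}) ` A"
  by (simp add: enc_osuc countable_enc_image)

lemma enc_conn: "i \<le> \<omega>\<^sub>1 \<Longrightarrow> enc i A \<in> nu i \<and> (\<forall>j\<le>i. conn i j (enc i A) = enc j A)"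
proof (induction i arbitrary: A rule: less_induct)
  case (less i)
  show ?case
  proof (cases i rule: ordinal_cases)
    case limit
    have "enc i A \<in> nu i"
      unfolding enc_limit[OF limit] nu_limit[OF limit]
      using less by (intro imageI CollectI) (auto split: if_splits)
    then show ?thesis
      using limit by (auto simp: enc_limit conn_limit conn_refl le_less)
  next
    case (osuc m)
    have m: "m < i" "m < \<omega>\<^sub>1" using osuc less.prems by (simp_all add: less_osuc osuc_le_iff)
    have IH: "enc m B \<in> nu m" "j \<le> m \<Longrightarrow> conn m j (enc m B) = enc j B" for B j
      using less.IH[OF m(1)] m(2) by auto
    have "enc i A \<in> nu i"
      using IH(1) countable_enc_image[OF m(2)]
      unfolding osuc enc_osuc nu_osuc by (intro imageI CollectI) auto
    \<comment> \<open>A second induction, on \<open>j\<close>, handles limit stages below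
      \<open>osuc m\<close>, where \<open>conn\<close> is given by its components.\<close>
    moreover have "conn i j (enc i A) = enc j A" if "j \<le> i" for j
      using that
    proof (induction j rule: less_induct)
      case inner: (less j)
      show ?case
      proof (cases j rule: ordinal_cases)
        case limit
        have "j < i" using limit inner.prems osuc not_limit_osuc le_less by auto
        then show ?thesis
          using limit inner.IH osuc by (auto simp: conn_osuc_limit enc_limit intro!: restrict_ext)
      next
        case jn: (osuc n)
        have n: "n \<le> m" using jn osuc inner.prems less_osuc_iff osuc_le_iff by auto
        have "cimage (conn m n) (acset ((\<lambda>k. enc m {..<k}) ` A)) = acset ((\<lambda>k. enc n {..<k}) ` A)"
          using n m(2) IH(2)[OF n] countable_enc_image
          by (intro rcset_inject[THEN iffD1]) (auto simp: cset.set_map image_image)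
        then show ?thesis by (simp add: jn osuc enc_osuc conn_osuc)
      qed
    qed
    ultimately show ?thesis by blast
  qed
qed

text \<open>Members at or above \<open>i\<close> look alike up to stage \<open>i\<close>, so it only
  matters that there is one; \<open>a\<close> and \<open>b\<close> witness this.\<close>

lemma enc_cong:
  assumes "A \<inter> {..<i} = B \<inter> {..<i}" "a \<in> A" "i \<le> a" "b \<in> B" "i \<le> b"
  shows "enc i A = enc i B"
  using assms
proof (induction i rule: less_induct)
  case (less i)
  show ?case
  proof (cases i rule: ordinal_cases)
    case limit
    have "enc j A = enc j B" if "j < i" for j
    proof (rule less.IH[OF that])
      show "A \<inter> {..<j} = B \<inter> {..<j}" using less.prems(1) that by fastforce
    qed (use less.prems that in auto)
    then show ?thesis by (auto simp: enc_limit[OF limit] intro!: restrict_ext)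
  next
    case (osuc m)
    have sub: "(\<lambda>k. enc m {..<k}) ` A' \<subseteq> (\<lambda>k. enc m {..<k}) ` B'"
      if "A' \<inter> {..<i} = B' \<inter> {..<i}" "b' \<in> B'" "i \<le> b'" for A' B' b'
    proof clarify
      fix k assume k: "k \<in> A'"
      show "enc m {..<k} \<in> (\<lambda>k. enc m {..<k}) ` B'"
      proof (cases "k < i")
        case True
        then show ?thesis using k that by blast
      next
        case False
        then have "m \<le> k" "m \<le> b'" using that(3) osuc less_osuc[of m] by auto
        then have "enc m {..<k} = enc m {..<b'}" by (simp add: enc_stable[of m k] enc_stable[of m b'])
        then show ?thesis using that(2) by blast
      qed
    qed
    have "(\<lambda>k. enc m {..<k}) ` A = (\<lambda>k. enc m {..<k}) ` B"
      using sub[OF less.prems(1,4,5)] sub[OF less.prems(1)[symmetric] less.prems(2,3)] by (rule equalityI)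
    then show ?thesis by (simp add: osuc enc_osuc)
  qed
qed

text \<open>Already at stage \<open>osuc s\<close>, \<open>{..<k}\<close> shows the successor
  \<open>{..<s}\<close>. To match it, \<open>{..<s}\<close> would need some \<open>l < s\<close>
  that looks like \<open>s\<close> at stage \<open>s\<close>, against the induction
  hypothesis.\<close>

lemma enc_lessThan_neq:
  assumes "s < k" "s < i" "i \<le> \<omega>\<^sub>1"
  shows "enc i {..<s} \<noteq> enc i {..<k}"
  using assms
proof (induction s arbitrary: i k rule: less_induct)
  case (less s)
  show ?case
  proof
    assume "enc i {..<s} = enc i {..<k}"
    then have "enc (osuc s) {..<s} = enc (osuc s) {..<k}"
      using less.prems enc_conn osuc_le_iff by metis
    then have "(\<lambda>l. enc s {..<l}) ` {..<s} = (\<lambda>l. enc s {..<l}) ` {..<k}"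
      using less.prems rcset_enc[of s] by (metis order.strict_trans2)
    then obtain l where "l < s" "enc s {..<s} = enc s {..<l}"
      using less.prems(1) by (metis (no_types, lifting) image_iff lessThan_iff)
    moreover have "s \<le> \<omega>\<^sub>1" using less.prems by order
    ultimately show False
      using less.IH[of l s s] by simp
  qed
qed

text \<open>Membership of \<open>s\<close> shows at stage \<open>osuc (osuc s)\<close>, whose sets
  consist of behaviours at stage \<open>osuc s\<close>, the first stage at which \<open>s\<close>
  differs from all other ordinals.\<close>

lemma enc_reveals:
  assumes "enc i A = enc i B" "osuc s < i" "i \<le> \<omega>\<^sub>1" "s \<in> A"
  shows "s \<in> B"
proof -
  have s: "osuc s < \<omega>\<^sub>1" using assms by order
  have "enc (osuc (osuc s)) A = enc (osuc (osuc s)) B"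
    using assms enc_conn osuc_le_iff by metis
  then have "(\<lambda>k. enc (osuc s) {..<k}) ` A = (\<lambda>k. enc (osuc s) {..<k}) ` B"
    using rcset_enc[OF s] by metis
  then obtain k where k: "k \<in> B" "enc (osuc s) {..<s} = enc (osuc s) {..<k}"
    using assms(4) by blast
  have "\<not> s < k"
    using enc_lessThan_neq[of s k "osuc s"] k(2) s less_osuc[of s] by (metis less_imp_le)
  moreover have "\<not> k < s"
    using enc_lessThan_neq[of k s "osuc s"] k(2) s less_osuc[of s] by (metis less_imp_le order.strict_trans)
  ultimately show ?thesis using k(1) by (metis linorder_neqE)
qed

section \<open>From elements to trees\<close>

lemma osuc_component:
  assumes "a \<in> nu \<omega>\<^sub>1" "i < \<omega>\<^sub>1" "j \<le> i"
  shows "rcset (members (component a (osuc i))) \<subseteq> nu i"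
    and "conn i j ` rcset (members (component a (osuc i))) = rcset (members (component a (osuc j)))"
proof -
  have si: "osuc i < \<omega>\<^sub>1" and sj: "osuc j < \<omega>\<^sub>1" "osuc j \<le> osuc i"
    using assms osuc_less_omega1 by (auto simp: osuc_le_iff less_osuc_iff)
  have a: "component a k \<in> nu k" if "k < \<omega>\<^sub>1" for k
    using conn_functorial[of a \<omega>\<^sub>1 k] conn_component[OF assms(1) limit_omega1 that] assms(1) that by auto
  have "conn (osuc i) (osuc j) (component a (osuc i)) = component a (osuc j)"
    using conn_functorial[of a \<omega>\<^sub>1 "osuc i"] conn_component[OF assms(1) limit_omega1] assms(1) si sj
    by (metis order.strict_implies_order)
  moreover obtain A where A: "component a (osuc i) = CSet A" "rcset A \<subseteq> nu i"
    using a[OF si] by (auto simp: nu_osuc)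
  ultimately show "rcset (members (component a (osuc i))) \<subseteq> nu i"
    and "conn i j ` rcset (members (component a (osuc i))) = rcset (members (component a (osuc j)))"
    by (simp_all add: conn_osuc) (metis cset.set_map elt.sel(1))
qed

lemma nu_limit_ext:
  assumes "limit_ord i" "x \<in> nu i" "y \<in> nu i" "\<And>j. j < i \<Longrightarrow> conn i j x = conn i j y"
  shows "x = y"
proof -
  obtain f g where "x = Family f" "f \<in> Pi\<^sub>E {..<i} nu" "y = Family g" "g \<in> Pi\<^sub>E {..<i} nu"
    using assms(1-3) by (auto simp: nu_limit)
  moreover from this have "f j = g j" if "j < i" for j
    using assms(1) assms(4)[OF that] that by (simp add: conn_limit)
  ultimately show ?thesis by (metis PiE_ext lessThan_iff)
qed

text \<open>Compatibility of \<open>a\<close> makes \<open>a\<^sub>j\<^sub>+\<^sub>1\<close> the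
  direct image of \<open>a\<^sub>i\<^sub>+\<^sub>1\<close>, whence surjectivity;
  \<open>nu_limit_ext\<close> separates nodes at limits. \<open>Family\<close> matches full branches
  with successors.\<close>

lemma tree_of_element:
  assumes a: "a \<in> nu \<omega>\<^sub>1"
  defines "D \<equiv> \<lambda>i. rcset (members (component a (osuc i)))"
  assumes ne: "D 0 \<noteq> {}"
  shows "tidy_tree D conn"
    and "|full_branches D conn {..<\<omega>\<^sub>1}| =o |{b. successor \<omega>\<^sub>1 a b}|"
proof -
  have nu: "x \<in> nu i" if "i < \<omega>\<^sub>1" "x \<in> D i" for i x
    using osuc_component(1)[OF a, of i i] that by (auto simp: D_def)
  have img: "conn i j ` D i = D j" if "i < \<omega>\<^sub>1" "j \<le> i" for i j
    using osuc_component(2)[OF a that] by (simp add: D_def)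
  show "tidy_tree D conn"
  proof (rule tidy_treeI)
    fix i j x assume "i < \<omega>\<^sub>1" "j \<le> i" "x \<in> D i"
    then show "conn i j x \<in> D j" using img by blast
  next
    fix i j y assume "i < \<omega>\<^sub>1" "j \<le> i" "y \<in> D j"
    then show "\<exists>x\<in>D i. conn i j x = y" using img by (metis imageE)
  next
    fix i j k x assume "i < \<omega>\<^sub>1" "j \<le> i" "k \<le> j" "x \<in> D i"
    then show "conn j k (conn i j x) = conn i k x" using nu conn_functorial by blast
  next
    fix i x y assume "i < \<omega>\<^sub>1" "limit_ord i" "x \<in> D i" "y \<in> D i"
      "\<And>j. j < i \<Longrightarrow> conn i j x = conn i j y"
    then show "x = y" using nu nu_limit_ext by blast
  qed (auto simp: conn_refl ne)
  have "{b. successor \<omega>\<^sub>1 a b} = Family ` full_branches D conn {..<\<omega>\<^sub>1}"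
  proof (intro equalityI subsetI)
    fix b assume "b \<in> {b. successor \<omega>\<^sub>1 a b}"
    then have b: "b \<in> nu \<omega>\<^sub>1" "\<And>j. j < \<omega>\<^sub>1 \<Longrightarrow> component b j \<in> D j"
      by (auto simp: successor_def D_def)
    then obtain f where f: "b = Family f" "f \<in> (\<Pi>\<^sub>E j\<in>{..<\<omega>\<^sub>1}. nu j)"
      "\<forall>j<\<omega>\<^sub>1. \<forall>k\<le>j. conn j k (f j) = f k"
      by (auto simp: nu_limit[OF limit_omega1])
    then have "f \<in> full_branches D conn {..<\<omega>\<^sub>1}"
      using b(2) by (auto simp: full_branches_def PiE_iff)
    then show "b \<in> Family ` full_branches D conn {..<\<omega>\<^sub>1}" using f(1) by blast
  next
    fix b assume "b \<in> Family ` full_branches D conn {..<\<omega>\<^sub>1}"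
    then obtain f where f: "b = Family f" "f \<in> full_branches D conn {..<\<omega>\<^sub>1}" by blast
    then have fD: "f j \<in> D j" if "j < \<omega>\<^sub>1" for j
      using that by (auto simp: full_branches_def)
    have "b \<in> nu \<omega>\<^sub>1"
      unfolding f(1) nu_limit[OF limit_omega1]
      using f(2) nu by (intro imageI CollectI) (auto simp: full_branches_def PiE_iff)
    then show "b \<in> {b. successor \<omega>\<^sub>1 a b}"
      using a fD f(1) by (auto simp: successor_def D_def)
  qed
  moreover have "inj_on Family X" for X by (auto intro: inj_onI)
  ultimately have "bij_betw Family (full_branches D conn {..<\<omega>\<^sub>1}) {b. successor \<omega>\<^sub>1 a b}"
    by (simp add: bij_betw_def)
  then show "|full_branches D conn {..<\<omega>\<^sub>1}| =o |{b. successor \<omega>\<^sub>1 a b}|"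
    by (rule card_of_ordIsoI)
qed

section \<open>From trees to elements\<close>

text \<open>Nodes are tagged by their level, as levels may overlap; a union of countable sets
  indexed by \<open>{..<\<omega>\<^sub>1}\<close> is no larger than its index set.\<close>

lemma node_numbering:
  assumes "\<And>i. i < \<omega>\<^sub>1 \<Longrightarrow> countable (D i)"
  shows "\<exists>r. inj_on (\<lambda>(j, x). r j x) (SIGMA j:{..<\<omega>\<^sub>1}. D j) \<and>
    (\<forall>j<\<omega>\<^sub>1. \<forall>x\<in>D j. r j x < \<omega>\<^sub>1)"
proof -
  have inf: "infinite {..<\<omega>\<^sub>1}"
    using uncountable_below_omega1 uncountable_infinite by blast
  have "|D j| \<le>o |{..<\<omega>\<^sub>1}|" if "j < \<omega>\<^sub>1" for j
    using assms[OF that] inf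
    by (meson countable_card_of_nat infinite_iff_card_of_nat ordLeq_transitive)
  then have "|SIGMA j:{..<\<omega>\<^sub>1}. D j| \<le>o |{..<\<omega>\<^sub>1}|"
    using inf by (intro card_of_Sigma_ordLeq_infinite) (auto intro: ordIso_imp_ordLeq card_of_refl)
  then obtain f where "inj_on f (SIGMA j:{..<\<omega>\<^sub>1}. D j)" "f ` (SIGMA j:{..<\<omega>\<^sub>1}. D j) \<subseteq> {..<\<omega>\<^sub>1}"
    by (auto simp: card_of_ordLeq[symmetric])
  then show ?thesis
    by (intro exI[of _ "\<lambda>j x. f (j, x)"]) auto
qed

locale numbered_tree =
  fixes D :: "ordinal \<Rightarrow> 't set" and d :: "ordinal \<Rightarrow> ordinal \<Rightarrow> 't \<Rightarrow> 't"
    and r :: "ordinal \<Rightarrow> 't \<Rightarrow> ordinal"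
  assumes tidy: "tidy_tree D d"
    and countable_level: "i < \<omega>\<^sub>1 \<Longrightarrow> countable (D i)"
    and r_inj_on: "inj_on (\<lambda>(j, x). r j x) (SIGMA j:{..<\<omega>\<^sub>1}. D j)"
    and r_bound: "j < \<omega>\<^sub>1 \<Longrightarrow> x \<in> D j \<Longrightarrow> r j x < \<omega>\<^sub>1"
begin

lemma r_inj:
  assumes "r j x = r k y" "j < \<omega>\<^sub>1" "x \<in> D j" "k < \<omega>\<^sub>1" "y \<in> D k"
  shows "j = k \<and> x = y"
  using inj_onD[OF r_inj_on, of "(j, x)" "(k, y)"] assms by auto

lemma d_map: "i < \<omega>\<^sub>1 \<Longrightarrow> j \<le> i \<Longrightarrow> x \<in> D i \<Longrightarrow> d i j x \<in> D j"
  using tidy by (auto simp: tidy_tree_def)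

lemma d_comp: "i < \<omega>\<^sub>1 \<Longrightarrow> j \<le> i \<Longrightarrow> k \<le> j \<Longrightarrow> x \<in> D i \<Longrightarrow> d j k (d i j x) = d i k x"
  using tidy by (auto simp: tidy_tree_def)

lemma d_image: "i < \<omega>\<^sub>1 \<Longrightarrow> j \<le> i \<Longrightarrow> d i j ` D i = D j"
  using tidy by (auto simp: tidy_tree_def)

text \<open>Choosing the least such level makes \<open>height\<close> monotone.\<close>

definition height :: "ordinal \<Rightarrow> ordinal" where
  "height k = (LEAST h. \<forall>j<\<omega>\<^sub>1. \<forall>x\<in>D j. r j x < k \<longrightarrow> j \<le> h)"

text \<open>Injectivity of \<open>r\<close> leaves only countably many nodes numbered below
  \<open>k\<close>, so their levels are bounded.\<close>

lemma
  assumes "k < \<omega>\<^sub>1"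
  shows height_bound: "height k < \<omega>\<^sub>1"
    and le_height: "j < \<omega>\<^sub>1 \<Longrightarrow> x \<in> D j \<Longrightarrow> r j x < k \<Longrightarrow> j \<le> height k"
proof -
  let ?P = "\<lambda>h. \<forall>j<\<omega>\<^sub>1. \<forall>x\<in>D j. r j x < k \<longrightarrow> j \<le> h"
  let ?B = "{(j, x) \<in> (SIGMA j:{..<\<omega>\<^sub>1}. D j). r j x < k}"
  have "(\<lambda>(j, x). r j x) ` ?B \<subseteq> {..<k}" by auto
  then have "countable ((\<lambda>(j, x). r j x) ` ?B)"
    using countable_below[OF assms] countable_subset by blast
  moreover have "inj_on (\<lambda>(j, x). r j x) ?B"
    by (rule inj_on_subset[OF r_inj_on]) auto
  ultimately have "countable (fst ` ?B)"
    using countable_image_inj_on countable_image by blast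
  moreover have "fst ` ?B \<subseteq> {..<\<omega>\<^sub>1}" by auto
  ultimately obtain h where h: "h < \<omega>\<^sub>1" "fst ` ?B \<subseteq> {..<h}"
    using countable_bounded by blast
  have "?P h"
  proof (intro allI ballI impI)
    fix j x assume "j < \<omega>\<^sub>1" "x \<in> D j" "r j x < k"
    then have "j \<in> fst ` ?B" by (intro image_eqI[of _ _ "(j, x)"]) auto
    then show "j \<le> h" using h(2) by auto
  qed
  then show "height k < \<omega>\<^sub>1"
    unfolding height_def using h(1) Least_le[of ?P h] by simp
  show "j < \<omega>\<^sub>1 \<Longrightarrow> x \<in> D j \<Longrightarrow> r j x < k \<Longrightarrow> j \<le> height k"
    unfolding height_def using LeastI[of ?P h, OF \<open>?P h\<close>] by blast
qed

lemma height_mono: "k \<le> k' \<Longrightarrow> k' < \<omega>\<^sub>1 \<Longrightarrow> height k \<le> height k'"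
  unfolding height_def[of k] using le_height[of k'] by (intro Least_le) auto

text \<open>The element \<open>\<omega>\<^sub>1\<close> makes all codes look unbounded at every countable stage.\<close>

definition code :: "ordinal \<Rightarrow> 't \<Rightarrow> ordinal set" where
  "code i x = insert \<omega>\<^sub>1 ((\<lambda>j. r j (d i j x)) ` {..i})"

definition branch_code :: "(ordinal \<Rightarrow> 't) \<Rightarrow> ordinal set" where
  "branch_code X = insert \<omega>\<^sub>1 ((\<lambda>j. r j (X j)) ` {..<\<omega>\<^sub>1})"

text \<open>Descending from level \<open>i\<close> to \<open>j\<close> discards only nodes above
  \<open>height k\<close>, numbered at least \<open>k\<close>; the common element
  \<open>\<omega>\<^sub>1\<close> supplies the witnesses for \<open>enc_cong\<close>.\<close>

lemma enc_code:
  assumes "k < \<omega>\<^sub>1" "height k \<le> j" "j \<le> i" "i < \<omega>\<^sub>1" "x \<in> D i"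
  shows "enc k (code j (d i j x)) = enc k (code i x)"
proof (rule enc_cong[of _ _ _ \<omega>\<^sub>1 \<omega>\<^sub>1])
  have "r l (d j l (d i j x)) = r l (d i l x)" if "l \<le> j" for l
    using that assms d_comp by simp
  moreover have "l \<le> j" if "l \<le> i" "r l (d i l x) < k" for l
    using le_height[OF assms(1), of l "d i l x"] that assms d_map by (meson order.strict_trans1 order.trans)
  ultimately show "code j (d i j x) \<inter> {..<k} = code i x \<inter> {..<k}"
    using assms by (fastforce simp: code_def image_iff)
qed (use assms in \<open>auto simp: code_def\<close>)

lemma enc_branch_code:
  assumes X: "X \<in> full_branches D d {..<\<omega>\<^sub>1}" and k: "k < \<omega>\<^sub>1"
  shows "enc k (branch_code X) = enc k (code (height k) (X (height k)))"
proof (rule enc_cong[of _ _ _ \<omega>\<^sub>1 \<omega>\<^sub>1])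
  have XD: "X j \<in> D j" "l \<le> j \<Longrightarrow> d j l (X j) = X l" if "j < \<omega>\<^sub>1" for j l
    using X that by (auto simp: full_branches_def)
  have h: "height k < \<omega>\<^sub>1" using k by (rule height_bound)
  have "j \<le> height k" if "j < \<omega>\<^sub>1" "r j (X j) < k" for j
    using le_height[OF k that(1) XD(1) that(2)] that by simp
  then show "branch_code X \<inter> {..<k} = code (height k) (X (height k)) \<inter> {..<k}"
    using h XD(2)[OF h] by (fastforce simp: code_def branch_code_def image_iff)
qed (use k in \<open>auto simp: code_def branch_code_def\<close>)

text \<open>Intended as \<open>a\<^sub>k\<^sub>+\<^sub>1\<close>. Any higher countable level would
  give the same set, by \<open>enc_code\<close> and surjectivity of \<open>d\<close>.\<close>

definition nodes :: "ordinal \<Rightarrow> elt set" where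
  "nodes k = (\<lambda>x. enc k (code (height k) x)) ` D (height k)"

lemma nodes_nu: "k < \<omega>\<^sub>1 \<Longrightarrow> nodes k \<subseteq> nu k"
  using enc_conn[of k] by (auto simp: nodes_def)

lemma countable_nodes: "k < \<omega>\<^sub>1 \<Longrightarrow> countable (nodes k)"
  using countable_level height_bound by (simp add: nodes_def)

text \<open>\<open>conn\<close> turns stage-\<open>k\<close> codes into stage-\<open>l\<close> codes
  of the same nodes, which \<open>enc_code\<close> then moves down to level
  \<open>height l\<close>.\<close>

lemma conn_nodes:
  assumes "k < \<omega>\<^sub>1" "l \<le> k"
  shows "conn k l ` nodes k = nodes l"
proof -
  have h: "height l \<le> height k" "height k < \<omega>\<^sub>1" and l: "l < \<omega>\<^sub>1"
    using assms height_mono height_bound by auto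
  have "conn k l ` nodes k = (\<lambda>x. enc l (code (height k) x)) ` D (height k)"
    using enc_conn assms by (simp add: nodes_def image_image)
  also have "\<dots> = (\<lambda>x. enc l (code (height l) (d (height k) (height l) x))) ` D (height k)"
    using enc_code[OF l order.refl h] by simp
  also have "\<dots> = nodes l"
    using d_image[OF h(2,1)] by (metis nodes_def image_image)
  finally show ?thesis .
qed

text \<open>Projecting the set \<open>nodes k\<close> from stage \<open>osuc k\<close> back to
  \<open>k\<close> gives all components, at limits and successors alike, by one formula.\<close>

definition element :: elt where
  "element = Family (\<lambda>k\<in>{..<\<omega>\<^sub>1}. conn (osuc k) k (CSet (acset (nodes k))))"

lemma conn_osuc_nodes:
  assumes "k < \<omega>\<^sub>1" "l \<le> k"
  shows "conn (osuc k) (osuc l) (CSet (acset (nodes k))) = CSet (acset (nodes l))"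
proof -
  have "rcset (cimage (conn k l) (acset (nodes k))) = rcset (acset (nodes l))"
    using assms conn_nodes[OF assms] countable_nodes[of k] countable_nodes[of l] by (simp add: cset.set_map)
  then show ?thesis by (simp add: conn_osuc rcset_inject)
qed

lemma
  shows element_nu: "element \<in> nu \<omega>\<^sub>1"
    and element_osuc: "k < \<omega>\<^sub>1 \<Longrightarrow> component element (osuc k) = CSet (acset (nodes k))"
proof -
  have c: "CSet (acset (nodes k)) \<in> nu (osuc k)" if "k < \<omega>\<^sub>1" for k
    using that nodes_nu countable_nodes unfolding nu_osuc by (intro imageI CollectI) simp
  have "conn k l (conn (osuc k) k (CSet (acset (nodes k)))) = conn (osuc l) l (CSet (acset (nodes l)))"
    if kl: "k < \<omega>\<^sub>1" "l \<le> k" for k l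
  proof -
    have ord: "k \<le> osuc k" "l \<le> osuc l" "osuc l \<le> osuc k"
      using kl by (auto simp: osuc_le_iff less_osuc_iff intro: less_imp_le less_osuc)
    have "conn k l (conn (osuc k) k (CSet (acset (nodes k)))) = conn (osuc k) l (CSet (acset (nodes k)))"
      using conn_functorial[OF c[OF kl(1)] ord(1)] kl by blast
    also have "\<dots> = conn (osuc l) l (conn (osuc k) (osuc l) (CSet (acset (nodes k))))"
      using conn_functorial[OF c[OF kl(1)] ord(3)] ord by simp
    finally show ?thesis using conn_osuc_nodes[OF kl] by simp
  qed
  moreover have "conn (osuc k) k (CSet (acset (nodes k))) \<in> nu k" if "k < \<omega>\<^sub>1" for k
    using conn_functorial[OF c[OF that]] less_osuc less_imp_le by blast
  ultimately show "element \<in> nu \<omega>\<^sub>1"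
    unfolding element_def nu_limit[OF limit_omega1]
    by (intro imageI CollectI) (auto split: if_splits)
  show "component element (osuc k) = CSet (acset (nodes k))" if "k < \<omega>\<^sub>1"
    \<comment> \<open>The component at \<open>osuc k\<close> is projected from stage
      \<open>osuc (osuc k)\<close>, and this takes \<open>nodes (osuc k)\<close> to
      \<open>nodes k\<close>.\<close>
    using conn_osuc_nodes[of "osuc k" k] that less_osuc[of k] osuc_less_omega1[of k]
    by (simp add: element_def)
qed

section \<open>Successors of the constructed element versus full branches of the tree\<close>

lemma successor_element_iff:
  "successor \<omega>\<^sub>1 element b \<longleftrightarrow> b \<in> nu \<omega>\<^sub>1 \<and> (\<forall>k<\<omega>\<^sub>1. component b k \<in> nodes k)"
  using element_nu element_osuc countable_nodes by (auto simp: successor_def)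

lemma successor_of_branch:
  assumes X: "X \<in> full_branches D d {..<\<omega>\<^sub>1}"
  shows "successor \<omega>\<^sub>1 element (enc \<omega>\<^sub>1 (branch_code X))"
  unfolding successor_element_iff
proof (intro conjI allI impI)
  show "enc \<omega>\<^sub>1 (branch_code X) \<in> nu \<omega>\<^sub>1" using enc_conn by simp
  fix k assume k: "k < \<omega>\<^sub>1"
  have "X (height k) \<in> D (height k)"
    using X height_bound[OF k] by (auto simp: full_branches_def)
  then show "component (enc \<omega>\<^sub>1 (branch_code X)) k \<in> nodes k"
    using k enc_branch_code[OF X k] by (simp add: enc_limit limit_omega1 nodes_def)
qed

text \<open>\<open>enc_reveals\<close> puts the number of each node of \<open>X\<close> into
  \<open>branch_code Y\<close>; injectivity of the numbering then yields that node, at the same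
  level, on \<open>Y\<close>.\<close>

lemma branch_code_inj: "inj_on (\<lambda>X. enc \<omega>\<^sub>1 (branch_code X)) (full_branches D d {..<\<omega>\<^sub>1})"
proof (rule inj_onI)
  fix X Y assume X: "X \<in> full_branches D d {..<\<omega>\<^sub>1}" and Y: "Y \<in> full_branches D d {..<\<omega>\<^sub>1}"
    and eq: "enc \<omega>\<^sub>1 (branch_code X) = enc \<omega>\<^sub>1 (branch_code Y)"
  have XY: "X j \<in> D j" "Y j \<in> D j" if "j < \<omega>\<^sub>1" for j
    using X Y that by (auto simp: full_branches_def)
  have "X j = Y j" if j: "j < \<omega>\<^sub>1" for j
  proof -
    have rj: "r j (X j) < \<omega>\<^sub>1" using j XY r_bound by blast
    then have "r j (X j) \<in> branch_code Y"
      using j by (intro enc_reveals[OF eq]) (auto simp: branch_code_def osuc_less_omega1)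
    then obtain k where "k < \<omega>\<^sub>1" "r j (X j) = r k (Y k)"
      using rj by (auto simp: branch_code_def)
    then show ?thesis using r_inj j XY by blast
  qed
  then show "X = Y"
    using X Y by (intro PiE_ext[of X "{..<\<omega>\<^sub>1}" D]) (auto simp: full_branches_def)
qed

text \<open>Provides a stage by which all numbers of level \<open>i\<close> are revealed; the
  \<open>osuc\<close> is the offset in \<open>enc_reveals\<close>.\<close>

lemma ex_number_bound:
  assumes "i < \<omega>\<^sub>1"
  shows "\<exists>k<\<omega>\<^sub>1. \<forall>x\<in>D i. osuc (r i x) < k"
proof -
  have "countable ((\<lambda>x. osuc (r i x)) ` D i)" "(\<lambda>x. osuc (r i x)) ` D i \<subseteq> {..<\<omega>\<^sub>1}"
    using assms countable_level r_bound osuc_less_omega1 by auto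
  then obtain k where "k < \<omega>\<^sub>1" "(\<lambda>x. osuc (r i x)) ` D i \<subseteq> {..<k}"
    using countable_bounded by blast
  then show ?thesis by (intro exI[of _ k]) auto
qed

text \<open>Each component is the code of some node \<open>x k\<close>, but these choices need not
  be compatible. From stage \<open>K i\<close> on, all numbers of level \<open>i\<close> are
  visible, so the ancestor of \<open>x k\<close> at level \<open>i\<close> no longer depends on
  \<open>k\<close>; the stable ancestors form \<open>X\<close>.\<close>

lemma branch_of_successor:
  assumes "successor \<omega>\<^sub>1 element b"
  shows "\<exists>X\<in>full_branches D d {..<\<omega>\<^sub>1}. b = enc \<omega>\<^sub>1 (branch_code X)"
proof -
  have b: "b \<in> nu \<omega>\<^sub>1" "\<And>k. k < \<omega>\<^sub>1 \<Longrightarrow> component b k \<in> nodes k"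
    using assms by (auto simp: successor_element_iff)
  obtain f where f: "b = Family f" "f \<in> (\<Pi>\<^sub>E j\<in>{..<\<omega>\<^sub>1}. nu j)"
      "\<And>j k. j < \<omega>\<^sub>1 \<Longrightarrow> k \<le> j \<Longrightarrow> conn j k (f j) = f k"
    using b(1) by (auto simp: nu_limit[OF limit_omega1])
  have "\<forall>k. \<exists>x. k < \<omega>\<^sub>1 \<longrightarrow> x \<in> D (height k) \<and> f k = enc k (code (height k) x)"
    using b(2) f(1) by (fastforce simp: nodes_def)
  then obtain x where x: "\<And>k. k < \<omega>\<^sub>1 \<Longrightarrow> x k \<in> D (height k)"
      "\<And>k. k < \<omega>\<^sub>1 \<Longrightarrow> f k = enc k (code (height k) (x k))"
    by metis
  let ?y = "\<lambda>k j. d (height k) j (x k)"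
  have yD: "?y k j \<in> D j" if "k < \<omega>\<^sub>1" "j \<le> height k" for k j
    using that x height_bound d_map by blast
  have enc_x: "enc l (code (height k) (x k)) = f l" if "k < \<omega>\<^sub>1" "l \<le> k" for k l
  proof -
    have "conn k l (f k) = enc l (code (height k) (x k))"
      using enc_conn[of k] that x(2) by simp
    then show ?thesis using f(3) that by simp
  qed
  obtain K where K: "\<And>i. i < \<omega>\<^sub>1 \<Longrightarrow> K i < \<omega>\<^sub>1" "\<And>i z. i < \<omega>\<^sub>1 \<Longrightarrow> z \<in> D i \<Longrightarrow> osuc (r i z) < K i"
    using ex_number_bound by metis
  have ht: "i \<le> height k" if "i < \<omega>\<^sub>1" "K i \<le> k" "k < \<omega>\<^sub>1" for i k
  proof -
    \<comment> \<open>A node of level \<open>i\<close> numbered below \<open>k\<close> forces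
      \<open>height k\<close> to reach \<open>i\<close>.\<close>
    obtain z where "z \<in> D i" using tidy_tree_nonempty[OF tidy \<open>i < \<omega>\<^sub>1\<close>] by blast
    then have "r i z < k" using K(2)[of i z] that less_osuc[of "r i z"] by simp
    then show ?thesis using le_height[OF that(3,1)] \<open>z \<in> D i\<close> by blast
  qed
  have y_eq: "?y k i = ?y (K i) i" if i: "i < \<omega>\<^sub>1" and k: "K i \<le> k" "k < \<omega>\<^sub>1" for i k
  proof -
    have Ki: "K i < \<omega>\<^sub>1" "i \<le> height (K i)" using K i ht by auto
    have z: "?y (K i) i \<in> D i" using yD Ki by blast
    \<comment> \<open>Both nodes have the code \<open>f (K i)\<close> at stage \<open>K i\<close>,
      so the number of the ancestor of one reappears below the other, and injectivity places it at
      level \<open>i\<close>.\<close>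
    have "enc (K i) (code (height (K i)) (x (K i))) = enc (K i) (code (height k) (x k))"
      using enc_x[of k "K i"] enc_x[of "K i" "K i"] k Ki by simp
    then have "r i (?y (K i) i) \<in> code (height k) (x k)"
      by (rule enc_reveals) (use K(2)[OF i z] Ki in \<open>auto simp: code_def\<close>)
    moreover have "r i (?y (K i) i) \<noteq> \<omega>\<^sub>1" using r_bound[OF i z] by simp
    ultimately obtain j where j: "j \<le> height k" "r i (?y (K i) i) = r j (?y k j)"
      by (auto simp: code_def)
    have "j < \<omega>\<^sub>1" using j(1) height_bound[OF k(2)] by simp
    then show ?thesis using r_inj[OF j(2) i z _ yD[OF k(2) j(1)]] by auto
  qed
  define X where "X = (\<lambda>i\<in>{..<\<omega>\<^sub>1}. ?y (K i) i)"
  have X: "X i = ?y k i" if "i < \<omega>\<^sub>1" "K i \<le> k" "k < \<omega>\<^sub>1" for i k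
    using y_eq[OF that] that(1) by (simp add: X_def)
  have branch: "X \<in> full_branches D d {..<\<omega>\<^sub>1}"
    unfolding full_branches_def
  proof (intro CollectI conjI ballI impI)
    show "X \<in> Pi\<^sub>E {..<\<omega>\<^sub>1} D"
      using yD ht K by (auto simp: X_def)
    fix i j assume "i \<in> {..<\<omega>\<^sub>1}" "j \<in> {..<\<omega>\<^sub>1}" and ji: "j \<le> i"
    then have ij: "i < \<omega>\<^sub>1" "j < \<omega>\<^sub>1" by auto
    define k where "k = max (K i) (K j)"
    have k: "K i \<le> k" "K j \<le> k" "k < \<omega>\<^sub>1" using K ij by (auto simp: k_def)
    have "d i j (?y k i) = ?y k j"
      using d_comp[OF height_bound[OF k(3)] ht[OF ij(1) k(1,3)] ji x(1)[OF k(3)]] .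
    then show "d i j (X i) = X j" using X[OF ij(1) k(1,3)] X[OF ij(2) k(2,3)] by simp
  qed
  have "f k = enc k (branch_code X)" if k: "k < \<omega>\<^sub>1" for k
  proof -
    let ?h = "height k"
    \<comment> \<open>Stage \<open>k'\<close> is late enough to determine \<open>f k\<close> and to
      have stabilised at level \<open>height k\<close>.\<close>
    define k' where "k' = max k (K ?h)"
    have h: "?h < \<omega>\<^sub>1" using k by (rule height_bound)
    have k': "k \<le> k'" "K ?h \<le> k'" "k' < \<omega>\<^sub>1" using K h k by (auto simp: k'_def)
    have "f k = enc k (code (height k') (x k'))"
      using enc_x k' by simp
    also have "\<dots> = enc k (code ?h (?y k' ?h))"
      using enc_code[OF k order.refl height_mono[OF k'(1,3)] height_bound[OF k'(3)] x(1)[OF k'(3)]] by simp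
    also have "\<dots> = enc k (branch_code X)"
      using X[OF h k'(2,3)] enc_branch_code[OF branch k] by simp
    finally show ?thesis .
  qed
  then have "f = (\<lambda>k\<in>{..<\<omega>\<^sub>1}. enc k (branch_code X))"
    using f(2) by (intro extensionalityI[of _ "{..<\<omega>\<^sub>1}"]) (auto simp: PiE_iff)
  then show ?thesis
    using branch f(1) by (auto simp: enc_limit limit_omega1)
qed

lemma card_successors: "|{b. successor \<omega>\<^sub>1 element b}| =o |full_branches D d {..<\<omega>\<^sub>1}|"
proof -
  have "(\<lambda>X. enc \<omega>\<^sub>1 (branch_code X)) ` full_branches D d {..<\<omega>\<^sub>1} = {b. successor \<omega>\<^sub>1 element b}"
    using successor_of_branch branch_of_successor by blast
  then show ?thesis
    using branch_code_inj card_of_ordIsoI ordIso_symmetric unfolding bij_betw_def by blast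
qed

end

theorem proposition7p3:
  fixes lam :: "'l rel"
  assumes "Card_order lam"
  shows "(\<exists>a\<in>nu \<omega>\<^sub>1. |{b. successor \<omega>\<^sub>1 a b}| =o lam) \<longleftrightarrow>
    (\<exists>(D :: ordinal \<Rightarrow> 't::infinite set) d.
       tidy_tree D d \<and> (\<forall>i<\<omega>\<^sub>1. countable (D i)) \<and> |full_branches D d {..<\<omega>\<^sub>1}| =o lam)"
proof (intro iffI; elim bexE exE conjE)
  fix a assume a: "a \<in> nu \<omega>\<^sub>1" "|{b. successor \<omega>\<^sub>1 a b}| =o lam"
  show "\<exists>(D :: ordinal \<Rightarrow> 't set) d.
       tidy_tree D d \<and> (\<forall>i<\<omega>\<^sub>1. countable (D i)) \<and> |full_branches D d {..<\<omega>\<^sub>1}| =o lam"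
  \<comment> \<open>If \<open>a\<^sub>1\<close> is empty, there is no root for a tree, but also no
    successor, as its component at \<open>0\<close> would lie in \<open>a\<^sub>1\<close>.\<close>
  proof (cases "rcset (members (component a (osuc 0))) = {}")
    case True
    have "{..<\<omega>\<^sub>1} \<noteq> {}" using uncountable_below_omega1 by force
    then have "0 < \<omega>\<^sub>1" using zero_le_ordinal order.strict_trans1 by blast
    then have "{b. successor \<omega>\<^sub>1 a b} = {}"
      using True by (auto simp: successor_def)
    then have "|full_branches aronszajn_level aronszajn_map {..<\<omega>\<^sub>1}| =o |{b. successor \<omega>\<^sub>1 a b}|"
      by (auto simp: aronszajn_no_full_branch bij_betw_def intro: card_of_ordIsoI)
    then have "|full_branches aronszajn_level aronszajn_map {..<\<omega>\<^sub>1}| =o lam"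
      using a(2) by (rule ordIso_transitive)
    with aronszajn_tidy countable_aronszajn_level show ?thesis by (rule tidy_tree_transfer)
  next
    case False
    show ?thesis
      by (rule tidy_tree_transfer[OF tree_of_element(1)[OF a(1) False] _
            ordIso_transitive[OF tree_of_element(2)[OF a(1) False] a(2)]]) simp
  qed
next
  fix D :: "ordinal \<Rightarrow> 't set" and d
  assume D: "tidy_tree D d" "\<forall>i<\<omega>\<^sub>1. countable (D i)" "|full_branches D d {..<\<omega>\<^sub>1}| =o lam"
  then obtain r where "inj_on (\<lambda>(j, x). r j x) (SIGMA j:{..<\<omega>\<^sub>1}. D j)"
    "\<forall>j<\<omega>\<^sub>1. \<forall>x\<in>D j. r j x < \<omega>\<^sub>1"
    using node_numbering[of D] by blast
  then interpret numbered_tree D d r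
    using D by unfold_locales auto
  show "\<exists>a\<in>nu \<omega>\<^sub>1. |{b. successor \<omega>\<^sub>1 a b}| =o lam"
    using element_nu card_successors D(3) ordIso_transitive by blast
qed

end
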